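(* Let $L\ge1$, let $0<R_1<\cdots<R_L\le R_*$ be distinct radii, let $\beta_1,\dots,\beta_L$ be jump coefficients such that all $\gamma_\ell=\beta_\ell R_\ell^2$ are nonzero, and set $$\xi_\ell=\frac{R_\ell^2}{R_*^2},\qquad \mu_m^{\rm rad}=\sum_{\ell=1}^{L}\gamma_\ell\,\xi_\ell^m\quad(m\ge0).$$ If $J\ge L$, the radial Hankel matrix $H_J^{\rm rad}=(\mu^{\rm rad}_{r+s})_{r,s=0}^{J-1}$ satisfies $$\operatorname{rank}H_J^{\rm rad}=L .$$ For the square $L\times L$ shifted pencil $H_1x=\xi H_0x$, where $H_0=(\mu^{\rm rad}_{r+s})_{r,s=0}^{L-1}$ and $H_1=(\mu^{\rm rad}_{r+s+1})_{r,s=0}^{L-1}$, the generalized eigenvalues are $\xi_1,\dots,\xi_L$, and $$R_\ell=R_*\sqrt{\xi_\ell},\qquad \ell=1,\dots,L.$$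
   Context: The quantities come from a piecewise-constant angular average of the contrast, $q_0(r)=\sum_{\ell=1}^{L}\beta_\ell\mathbf 1_{[0,R_\ell)}(r)$, where $R_*\ge R_L$ is a reference radius; the $\beta_\ell$ are the jumps of the radial profile and may have either sign. *)

theory Defs
  imports Complex_Main "Jordan_Normal_Form.Char_Poly" "Jordan_Normal_Form.DL_Rank"
begin

(* The radii R l and jumps \<beta> l are indexed by l \<in> {1..L}, as in the profile
   q0(r) = (\<Sum>l=1..L. \<beta> l * indicator {0..<R l} r); values outside {1..L} are never used.
   Rs is the reference radius. *)

definition rad_weight :: "(nat \<Rightarrow> real) \<Rightarrow> (nat \<Rightarrow> real) \<Rightarrow> nat \<Rightarrow> real" where
  "rad_weight \<beta> R l = \<beta> l * (R l)\<^sup>2"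

definition rad_node :: "real \<Rightarrow> (nat \<Rightarrow> real) \<Rightarrow> nat \<Rightarrow> real" where
  "rad_node Rs R l = (R l)\<^sup>2 / Rs\<^sup>2"

definition rad_moment ::
    "nat \<Rightarrow> (nat \<Rightarrow> real) \<Rightarrow> real \<Rightarrow> (nat \<Rightarrow> real) \<Rightarrow> nat \<Rightarrow> real" where
  "rad_moment L \<beta> Rs R m = (\<Sum>l=1..L. rad_weight \<beta> R l * rad_node Rs R l ^ m)"

definition hankel_mat :: "(nat \<Rightarrow> 'a) \<Rightarrow> nat \<Rightarrow> 'a mat" where
  "hankel_mat \<mu> n = mat n n (\<lambda>(r, s). \<mu> (r + s))"

definition shifted_hankel_mat :: "(nat \<Rightarrow> 'a) \<Rightarrow> nat \<Rightarrow> 'a mat" where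
  "shifted_hankel_mat \<mu> n = mat n n (\<lambda>(r, s). \<mu> (r + s + 1))"

(* The finite complex generalized eigenvalues z of the square real pencil A x = z B x.
   If the pencil is singular (det (A - z B) = 0 for every z), this is all of \<complex>. *)
definition pencil_eigenvalues :: "real mat \<Rightarrow> real mat \<Rightarrow> complex set" where
  "pencil_eigenvalues A B =
     {z. \<exists>x \<in> carrier_vec (dim_col A). x \<noteq> 0\<^sub>v (dim_col A) \<and>
         map_mat complex_of_real A *\<^sub>v x = z \<cdot>\<^sub>v (map_mat complex_of_real B *\<^sub>v x)}"

end

theory Submission
  imports Defs
begin

text \<open>
  Identify a vector \<open>v\<close> of length \<open>n\<close> with the polynomial \<open>p\<close> of degree below \<open>n\<close> whose
  coefficients it lists. For moments \<open>\<mu> m = (\<Sum>l<L. w l * x l ^ m)\<close> the Hankel matrix then acts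
  by evaluating \<open>p\<close> at the nodes, multiplying by the weights, and taking moments again:
  \<open>(H v)\<^sub>r = (\<Sum>l<L. w l * p (x l) * x l ^ r)\<close>
  (\<open>hankel_mat_mult_poly_coeffs\<close>). Both claims follow from Lagrange interpolation at the \<open>L\<close>
  distinct nodes.

  \<^emph>\<open>Rank.\<close> Since \<open>L \<le> n\<close> and the weights are nonzero, the numbers \<open>w l * p (x l)\<close> can be
  prescribed arbitrarily by the choice of \<open>p\<close>. So the column space of \<open>H\<close> is that of the
  \<open>n \<times> L\<close> Vandermonde matrix, whose columns are linearly independent: pairing a vanishing
  combination of them with an interpolating polynomial isolates each coefficient
  (\<open>weights_eq_0_if_moments_eq_0\<close>).

  \<^emph>\<open>Pencil.\<close> Shifting the moments by one multiplies \<open>w l\<close> by \<open>x l\<close>, so \<open>H\<^sub>1 v = z H\<^sub>0 v\<close>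
  says that the first \<open>L\<close> moments of the weights \<open>w l * (x l - z) * p (x l)\<close> vanish, that is,
  that \<open>p\<close> vanishes at every node other than \<open>z\<close>. A nonzero \<open>p\<close> of degree below \<open>L\<close> cannot
  vanish at all \<open>L\<close> nodes, so \<open>z\<close> is a node; conversely the Lagrange basis polynomial
  of a node is an eigenvector for it.
\<close>

section \<open>Interpolation and vectors as polynomials\<close>

lemma interpolation_poly_exists:
  fixes x y :: "'i \<Rightarrow> 'a::field"
  assumes "finite A" "A \<noteq> {}" "inj_on x A"
  obtains p where "degree p < card A" "\<And>l. l \<in> A \<Longrightarrow> poly p (x l) = y l"
proof -
  (* b k is the Lagrange basis polynomial of x k before normalization *)
  define b where "b k = (\<Prod>j\<in>A - {k}. [:- x j, 1:])" for k
  define p where "p = (\<Sum>k\<in>A. Polynomial.smult (y k / poly (b k) (x k)) (b k))"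
  have b_nz: "poly (b k) (x k) \<noteq> 0" if "k \<in> A" for k
    using that assms by (auto simp: b_def poly_prod inj_on_def)
  have b_z: "poly (b k) (x l) = 0" if "l \<in> A" "l \<noteq> k" for k l
    using that assms(1) by (auto simp: b_def poly_prod)
  have b_deg: "degree (b k) = card A - 1" if "k \<in> A" for k
    using that assms(1) by (simp add: b_def degree_prod_sum_eq)
  have "degree p \<le> card A - 1"
    unfolding p_def using assms(1) b_deg
    by (intro degree_sum_le) (auto intro: order.trans[OF degree_smult_le])
  moreover have "card A > 0"
    using assms by (simp add: card_gt_0_iff)
  ultimately have "degree p < card A"
    by linarith
  moreover have "poly p (x l) = y l" if l: "l \<in> A" for l
  proof -
    have "poly p (x l) = (\<Sum>k\<in>A. y k / poly (b k) (x k) * poly (b k) (x l))"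
      by (simp add: p_def poly_sum)
    also have "\<dots> = (\<Sum>k\<in>A. if k = l then y k else 0)"
      using b_nz b_z l by (intro sum.cong) auto
    also have "\<dots> = y l"
      using l assms(1) by simp
    finally show ?thesis .
  qed
  ultimately show thesis
    using that by blast
qed

lemma poly_eq_sum_lessThan:
  fixes p :: "'a::comm_semiring_1 poly"
  assumes "degree p < n"
  shows "poly p t = (\<Sum>i<n. coeff p i * t ^ i)"
proof -
  have "(\<Sum>i\<le>degree p. coeff p i * t ^ i) = (\<Sum>i<n. coeff p i * t ^ i)"
    using assms by (intro sum.mono_neutral_left) (auto simp: coeff_eq_0)
  then show ?thesis
    by (simp add: poly_altdef)
qed

lemma vec_eq_poly_coeffs:
  fixes v :: "'a::comm_semiring_1 vec"
  assumes "v \<in> carrier_vec n" "0 < n"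
  obtains p where "degree p < n" "v = vec n (coeff p)"
proof
  let ?p = "Poly (list_of_vec v)"
  have c: "coeff ?p i = (if i < n then v $ i else 0)" for i
    using assms by (auto simp: coeff_Poly_eq nth_default_def list_of_vec_index)
  show "degree ?p < n"
    using assms(2) c by (intro degree_lessI) auto
  show "v = vec n (coeff ?p)"
    using assms(1) c by (intro eq_vecI) auto
qed

text \<open>
  Independence of the Vandermonde columns, without determinants: the hypothesis extends by
  linearity to \<open>(\<Sum>l\<in>A. c l * poly p (x l)) = 0\<close> for every \<open>p\<close> of degree below \<open>n\<close>, and the
  Lagrange basis polynomial of \<open>x k\<close> turns this sum into \<open>c k\<close>.
\<close>

lemma weights_eq_0_if_moments_eq_0:
  fixes x c :: "'i \<Rightarrow> 'a::field"
  assumes "finite A" "inj_on x A" "card A \<le> n"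
    and zero: "\<And>r. r < n \<Longrightarrow> (\<Sum>l\<in>A. c l * x l ^ r) = 0"
    and k: "k \<in> A"
  shows "c k = 0"
proof -
  obtain p where deg: "degree p < card A"
    and p: "\<And>l. l \<in> A \<Longrightarrow> poly p (x l) = (if l = k then 1 else 0)"
    using interpolation_poly_exists[of A x "\<lambda>l. if l = k then 1 else 0"] assms by blast
  have "c k = (\<Sum>l\<in>A. if l = k then c l else 0)"
    using assms(1) k by simp
  also have "\<dots> = (\<Sum>l\<in>A. c l * poly p (x l))"
    using p by (intro sum.cong) auto
  also have "\<dots> = (\<Sum>l\<in>A. \<Sum>r<n. coeff p r * (c l * x l ^ r))"
    using deg assms(3)
    by (simp add: poly_eq_sum_lessThan[of p n] sum_distrib_left mult_ac)
  also have "\<dots> = (\<Sum>r<n. coeff p r * (\<Sum>l\<in>A. c l * x l ^ r))"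
    unfolding sum_distrib_left by (rule sum.swap)
  also have "\<dots> = 0"
    using zero by simp
  finally show ?thesis .
qed

section \<open>Rank of a Hankel matrix of moments\<close>

text \<open>
  The factorization \<open>H = V D V\<^sup>T\<close> of the Hankel matrix, read on polynomials: \<open>V\<^sup>T\<close> evaluates
  \<open>p\<close> at the nodes, the diagonal matrix \<open>D\<close> applies the weights and \<open>V\<close> takes moments. In this
  form interpolation replaces any inversion of \<open>V\<close>.
\<close>

lemma hankel_mat_mult_poly_coeffs:
  fixes x w :: "'i \<Rightarrow> 'a::comm_semiring_1"
  assumes "degree p < n"
  shows "hankel_mat (\<lambda>m. \<Sum>l\<in>A. w l * x l ^ m) n *\<^sub>v vec n (coeff p)
    = vec n (\<lambda>r. \<Sum>l\<in>A. w l * poly p (x l) * x l ^ r)"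
proof (rule eq_vecI)
  fix r assume "r < dim_vec (vec n (\<lambda>r. \<Sum>l\<in>A. w l * poly p (x l) * x l ^ r))"
  then have r: "r < n" by simp
  have "(hankel_mat (\<lambda>m. \<Sum>l\<in>A. w l * x l ^ m) n *\<^sub>v vec n (coeff p)) $ r
      = (\<Sum>s<n. \<Sum>l\<in>A. w l * (coeff p s * x l ^ s) * x l ^ r)"
    using r by (simp add: hankel_mat_def scalar_prod_def atLeast0LessThan
        sum_distrib_left sum_distrib_right power_add mult_ac)
  also have "\<dots> = (\<Sum>l\<in>A. w l * poly p (x l) * x l ^ r)"
    unfolding poly_eq_sum_lessThan[OF assms] sum_distrib_left sum_distrib_right
    by (rule sum.swap)
  finally show "(hankel_mat (\<lambda>m. \<Sum>l\<in>A. w l * x l ^ m) n *\<^sub>v vec n (coeff p)) $ r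
      = vec n (\<lambda>r. \<Sum>l\<in>A. w l * poly p (x l) * x l ^ r) $ r"
    using r by simp
qed (simp add: hankel_mat_def)

definition vandermonde_mat :: "(nat \<Rightarrow> 'a::comm_semiring_1) \<Rightarrow> nat \<Rightarrow> nat \<Rightarrow> 'a mat" where
  "vandermonde_mat x n L = mat n L (\<lambda>(r, l). x l ^ r)"

lemma vandermonde_mat_carrier [simp]: "vandermonde_mat x n L \<in> carrier_mat n L"
  by (simp add: vandermonde_mat_def)

lemma vandermonde_mat_mult_vec:
  "vandermonde_mat x n L *\<^sub>v vec L c = vec n (\<lambda>r. \<Sum>l<L. c l * x l ^ r)"
  by (rule eq_vecI)
    (simp_all add: vandermonde_mat_def scalar_prod_def atLeast0LessThan mult.commute)

lemma rank_vandermonde_mat: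
  fixes x :: "nat \<Rightarrow> 'a::field"
  assumes inj: "inj_on x {..<L}" and "L \<le> n"
  shows "vec_space.rank n (vandermonde_mat x n L) = L"
proof -
  interpret vec_space "TYPE('a)" n .
  let ?V = "vandermonde_mat x n L"
  have dist: "distinct (cols ?V)"
  proof -
    have "col ?V i \<noteq> col ?V j" if ij: "i < L" "j < L" "i \<noteq> j" for i j
    proof
      assume eq: "col ?V i = col ?V j"
      (* two different columns force n > 1, and row 1 contains the nodes themselves *)
      have "1 < n"
        using ij assms(2) by linarith
      then have "col ?V i $ 1 = x i" "col ?V j $ 1 = x j"
        using ij by (simp_all add: vandermonde_mat_def)
      then show False
        using eq ij inj by (auto simp: inj_on_def)
    qed
    then show ?thesis
      by (auto simp: distinct_conv_nth vandermonde_mat_def)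
  qed
  have "lin_indpt (set (cols ?V))"
  proof
    assume "lin_dep (set (cols ?V))"
    then obtain v where v: "v \<in> carrier_vec L" "v \<noteq> 0\<^sub>v L" "?V *\<^sub>v v = 0\<^sub>v n"
      using lin_depE[OF vandermonde_mat_carrier _ dist] by blast
    have "v = vec L (\<lambda>l. v $ l)"
      using v(1) by auto
    with v(3) have zero: "vec n (\<lambda>r. \<Sum>l<L. v $ l * x l ^ r) = 0\<^sub>v n"
      using vandermonde_mat_mult_vec[of x n L "\<lambda>l. v $ l"] by simp
    have "(\<Sum>l<L. v $ l * x l ^ r) = 0" if "r < n" for r
      using arg_cong[OF zero, of "\<lambda>u. u $ r"] that by simp
    then have "v $ l = 0" if "l < L" for l
      using weights_eq_0_if_moments_eq_0[of "{..<L}" x n "\<lambda>l. v $ l" l] that assms by simp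
    then have "v = 0\<^sub>v L"
      using v(1) by auto
    with v(2) show False ..
  qed
  then show ?thesis
    using lin_indpt_full_rank[OF vandermonde_mat_carrier dist] by blast
qed

text \<open>
  The Hankel matrix has the same column space as the Vandermonde matrix \<open>V\<close>: a vector \<open>V c\<close> is
  \<open>H\<close> applied to the coefficients of a polynomial with values \<open>c l / w l\<close> at the nodes, which
  exists within degree \<open>L - 1 < n\<close>.
\<close>

lemma rank_hankel_mat_moments:
  fixes x w :: "nat \<Rightarrow> 'a::field"
  assumes "0 < L" "L \<le> n" and inj: "inj_on x {..<L}"
    and w: "\<And>l. l < L \<Longrightarrow> w l \<noteq> 0"
  shows "vec_space.rank n (hankel_mat (\<lambda>m. \<Sum>l<L. w l * x l ^ m) n) = L"
proof -
  interpret vec_space "TYPE('a)" n .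
  let ?H = "hankel_mat (\<lambda>m. \<Sum>l<L. w l * x l ^ m) n"
  let ?V = "vandermonde_mat x n L"
  have H: "?H \<in> carrier_mat n n"
    by (simp add: hankel_mat_def)
  have V: "?V \<in> carrier_mat n L"
    by simp
  have in_col_space: "B *\<^sub>v v \<in> col_space B"
    if "B \<in> carrier_mat n m" "v \<in> carrier_vec m" for B m v
    using that mult_mat_vec_carrier[OF that] unfolding col_space_eq[OF that(1)] by auto
  have "col_space ?H = col_space ?V"
  proof (intro Set.set_eqI iffI)
    fix u assume "u \<in> col_space ?H"
    then obtain v where v: "v \<in> carrier_vec n" and u: "u = ?H *\<^sub>v v"
      using H by (auto simp: col_space_eq[OF H])
    obtain p where p: "degree p < n" "v = vec n (coeff p)"
      using vec_eq_poly_coeffs[OF v] assms by auto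
    have "u = ?V *\<^sub>v vec L (\<lambda>l. w l * poly p (x l))"
      unfolding u p(2) hankel_mat_mult_poly_coeffs[OF p(1)] vandermonde_mat_mult_vec ..
    then show "u \<in> col_space ?V"
      using in_col_space[OF V] by simp
  next
    fix u assume "u \<in> col_space ?V"
    then obtain c where c: "c \<in> carrier_vec L" and u: "u = ?V *\<^sub>v c"
      using V by (auto simp: col_space_eq[OF V])
    obtain p where p: "degree p < card {..<L}"
        "\<And>l. l \<in> {..<L} \<Longrightarrow> poly p (x l) = c $ l / w l"
      using interpolation_poly_exists[of "{..<L}" x "\<lambda>l. c $ l / w l"] assms by blast
    have deg: "degree p < n"
      using p(1) assms(2) by simp
    have "c = vec L (\<lambda>l. w l * poly p (x l))"
      using c p(2) w by (intro eq_vecI) auto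
    then have "u = ?H *\<^sub>v vec n (coeff p)"
      unfolding u hankel_mat_mult_poly_coeffs[OF deg] by (metis vandermonde_mat_mult_vec)
    then show "u \<in> col_space ?H"
      using in_col_space[OF H] by simp
  qed
  then have "rank ?H = rank ?V"
    by (simp add: rank_def col_space_def)
  then show ?thesis
    using rank_vandermonde_mat[OF inj assms(2)] by simp
qed

section \<open>Eigenvalues of the shifted pencil\<close>

text \<open>
  Eigenvectors for \<open>z\<close> are the coefficient vectors of the nonzero polynomials of degree below
  \<open>L\<close> that vanish at every node different from \<open>z\<close>. The argument is carried out over the complex
  numbers, where the embedded weights and nodes keep the hypotheses.
\<close>

lemma pencil_eigenvalues_hankel_mat_moments:
  fixes x w :: "nat \<Rightarrow> real"
  assumes "0 < L" and inj: "inj_on x {..<L}"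
    and w: "\<And>l. l < L \<Longrightarrow> w l \<noteq> 0"
  defines "\<mu> \<equiv> \<lambda>m. \<Sum>l<L. w l * x l ^ m"
  shows "pencil_eigenvalues (shifted_hankel_mat \<mu> L) (hankel_mat \<mu> L)
    = (\<lambda>l. complex_of_real (x l)) ` {..<L}"
proof -
  define X where "X l = complex_of_real (x l)" for l
  define W where "W l = complex_of_real (w l)" for l
  have injX: "inj_on X {..<L}"
    using inj by (auto simp: inj_on_def X_def)
  have H0: "map_mat complex_of_real (hankel_mat \<mu> L)
      = hankel_mat (\<lambda>m. \<Sum>l<L. W l * X l ^ m) L"
    by (rule eq_matI) (auto simp: hankel_mat_def \<mu>_def W_def X_def)
  (* the shift by one multiplies each weight by its node *)
  have H1: "map_mat complex_of_real (shifted_hankel_mat \<mu> L)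
      = hankel_mat (\<lambda>m. \<Sum>l<L. W l * X l * X l ^ m) L"
    by (rule eq_matI)
      (auto simp: hankel_mat_def shifted_hankel_mat_def \<mu>_def W_def X_def mult_ac)
  have pencil_iff: "map_mat complex_of_real (shifted_hankel_mat \<mu> L) *\<^sub>v vec L (coeff p)
        = z \<cdot>\<^sub>v (map_mat complex_of_real (hankel_mat \<mu> L) *\<^sub>v vec L (coeff p))
      \<longleftrightarrow> (\<forall>l<L. X l = z \<or> poly p (X l) = 0)" (is "?lhs \<longleftrightarrow> ?rhs")
    if deg: "degree p < L" for p z
  proof -
    have "?lhs \<longleftrightarrow> (\<forall>r<L. (\<Sum>l<L. W l * X l * poly p (X l) * X l ^ r)
        = z * (\<Sum>l<L. W l * poly p (X l) * X l ^ r))"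
      unfolding H0 H1 hankel_mat_mult_poly_coeffs[OF deg] by (auto simp: vec_eq_iff)
    also have "\<dots> \<longleftrightarrow> (\<forall>r<L. (\<Sum>l<L. W l * (X l - z) * poly p (X l) * X l ^ r) = 0)"
      by (simp add: sum_distrib_left sum_subtractf algebra_simps)
    also have "\<dots> \<longleftrightarrow> (\<forall>l<L. W l * (X l - z) * poly p (X l) = 0)"
      using weights_eq_0_if_moments_eq_0[of "{..<L}" X L
          "\<lambda>l. W l * (X l - z) * poly p (X l)"] injX
      by (intro iffI) (auto intro!: sum.neutral)
    also have "\<dots> \<longleftrightarrow> ?rhs"
      using w by (auto simp: W_def)
    finally show ?thesis .
  qed
  have dim: "dim_col (shifted_hankel_mat \<mu> L) = L"
    by (simp add: shifted_hankel_mat_def)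
  show ?thesis
    unfolding X_def[symmetric]
  proof (intro Set.set_eqI iffI)
    fix z assume "z \<in> pencil_eigenvalues (shifted_hankel_mat \<mu> L) (hankel_mat \<mu> L)"
    then obtain v where v: "v \<in> carrier_vec L" "v \<noteq> 0\<^sub>v L"
      and eig: "map_mat complex_of_real (shifted_hankel_mat \<mu> L) *\<^sub>v v
        = z \<cdot>\<^sub>v (map_mat complex_of_real (hankel_mat \<mu> L) *\<^sub>v v)"
      by (auto simp: pencil_eigenvalues_def dim)
    obtain p where p: "degree p < L" "v = vec L (coeff p)"
      using vec_eq_poly_coeffs[OF v(1) assms(1)] by blast
    have "p \<noteq> 0"
      using v(2) p(2) by (auto simp: zero_vec_def)
    show "z \<in> X ` {..<L}"
    proof (rule ccontr)
      assume "z \<notin> X ` {..<L}"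
      then have "poly p u = poly 0 u" if "u \<in> X ` {..<L}" for u
        using that eig pencil_iff[OF p(1)] p(2) by auto
      moreover have "card (X ` {..<L}) = L"
        using injX by (simp add: card_image)
      ultimately have "p = 0"
        using poly_eqI_degree[of "X ` {..<L}" p 0] p(1) assms(1) by simp
      with \<open>p \<noteq> 0\<close> show False ..
    qed
  next
    fix z assume "z \<in> X ` {..<L}"
    then obtain k where k: "k < L" and z: "z = X k"
      by auto
    obtain p where p: "degree p < card {..<L}"
        "\<And>l. l \<in> {..<L} \<Longrightarrow> poly p (X l) = (if l = k then 1 else 0)"
      using interpolation_poly_exists[of "{..<L}" X "\<lambda>l. if l = k then 1 else 0"]
        injX assms(1) by blast
    have deg: "degree p < L"
      using p(1) by simp
    have "vec L (coeff p) \<noteq> 0\<^sub>v L"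
    proof
      assume zero: "vec L (coeff p) = 0\<^sub>v L"
      have "coeff p i = 0" if "i < L" for i
        using arg_cong[OF zero, of "\<lambda>u. u $ i"] that by simp
      then have "poly p (X k) = 0"
        by (simp add: poly_eq_sum_lessThan[OF deg])
      then show False
        using p(2) k by simp
    qed
    moreover have "\<forall>l<L. X l = z \<or> poly p (X l) = 0"
      using p(2) z by auto
    ultimately show "z \<in> pencil_eigenvalues (shifted_hankel_mat \<mu> L) (hankel_mat \<mu> L)"
      using pencil_iff[OF deg] by (auto simp: pencil_eigenvalues_def dim)
  qed
qed

section \<open>The radial Hankel matrix\<close>

theorem theorem2p9:
  fixes L :: nat and R \<beta> :: "nat \<Rightarrow> real" and Rs :: real
  assumes "L \<ge> 1"
    and "\<And>l. l \<in> {1..L} \<Longrightarrow> 0 < R l"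
    and "strict_mono_on {1..L} R"
    and "R L \<le> Rs"
    and "\<And>l. l \<in> {1..L} \<Longrightarrow> rad_weight \<beta> R l \<noteq> 0"
  shows "(\<forall>J\<ge>L. vec_space.rank J (hankel_mat (rad_moment L \<beta> Rs R) J) = L) \<and>
    pencil_eigenvalues (shifted_hankel_mat (rad_moment L \<beta> Rs R) L)
        (hankel_mat (rad_moment L \<beta> Rs R) L)
      = (\<lambda>l. complex_of_real (rad_node Rs R l)) ` {1..L} \<and>
    (\<forall>l\<in>{1..L}. R l = Rs * sqrt (rad_node Rs R l))"
proof -
  have Rs: "0 < Rs"
    using assms(1,2,4) by (metis atLeastAtMost_iff order.refl order.strict_trans2)
  have radius: "R l = Rs * sqrt (rad_node Rs R l)" if "l \<in> {1..L}" for l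
    using assms(2)[OF that] Rs by (simp add: rad_node_def real_sqrt_divide)
  (* the radius formula recovers R from the node, so equal nodes force equal radii *)
  have "inj_on (rad_node Rs R) {1..L}"
  proof (rule inj_onI)
    fix k l assume kl: "k \<in> {1..L}" "l \<in> {1..L}" "rad_node Rs R k = rad_node Rs R l"
    then have "R k = R l"
      using radius[of k] radius[of l] by simp
    then show "k = l"
      using strict_mono_on_imp_inj_on[OF assms(3)] kl by (simp add: inj_on_eq_iff)
  qed
  then have inj: "inj_on (\<lambda>i. rad_node Rs R (Suc i)) {..<L}"
    by (intro inj_onI) (auto dest: inj_onD)
  have moment: "rad_moment L \<beta> Rs R
      = (\<lambda>m. \<Sum>i<L. rad_weight \<beta> R (Suc i) * rad_node Rs R (Suc i) ^ m)"
    by (simp add: fun_eq_iff rad_moment_def sum.atLeast1_atMost_eq)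
  have w: "rad_weight \<beta> R (Suc i) \<noteq> 0" if "i < L" for i
    using assms(5) that by simp
  (* the nodes above are numbered from 0, the radii from 1 *)
  have "{1..L} = Suc ` {..<L}"
    by (simp add: image_Suc_lessThan)
  then have nodes: "(\<lambda>l. complex_of_real (rad_node Rs R l)) ` {1..L}
      = (\<lambda>i. complex_of_real (rad_node Rs R (Suc i))) ` {..<L}"
    by (simp add: image_image)
  have "vec_space.rank J (hankel_mat (rad_moment L \<beta> Rs R) J) = L" if "J \<ge> L" for J
    unfolding moment
    using rank_hankel_mat_moments[where n = J, OF _ that inj w] assms(1) by simp
  moreover have "pencil_eigenvalues (shifted_hankel_mat (rad_moment L \<beta> Rs R) L)
        (hankel_mat (rad_moment L \<beta> Rs R) L)
      = (\<lambda>l. complex_of_real (rad_node Rs R l)) ` {1..L}"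
    unfolding moment nodes
    using pencil_eigenvalues_hankel_mat_moments[OF _ inj w] assms(1) by simp
  ultimately show ?thesis
    using radius by blast
qed

end
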